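(* Let $H$ be a separable complex Hilbert space and let $A$ be a (bounded or unbounded) self-adjoint operator in $H$ with domain $D(A)$ whose spectrum consists of simple eigenvalues $\lambda_j$, $j\in\mathbb{Z}$, with $\lambda_j<\lambda_{j+1}$ for all $j\in\mathbb{Z}$. Let $\{e_j\}_{j\in\mathbb{Z}}$ be the corresponding orthonormal basis of eigenvectors, $Ae_j=\lambda_j e_j$. Let $f\in C^\infty(A)=\bigcap_{m\ge 1}D(A^m)$ satisfy, for each integer $k$, the conditions $1^\circ$. $(f,e_k)\neq 0$; $2^\circ$. $\displaystyle\lim_{n\to\infty}\frac{1}{\dot P_{2n+1}^2(\lambda_k)}\sum_{|s|>n}\frac{P_{2n+1}^2(\lambda_s)\,|(f,e_s)|^2}{(\lambda_s-\lambda_k)^2}=0$, where $P_{2n+1}(\lambda)=\prod_{i=-n}^{n}(\lambda-\lambda_i)$, $\dot P_{2n+1}(\lambda)=\frac{d}{d\lambda}P_{2n+1}(\lambda)$, and the sum is over all integers $s$ with $|s|>n$. Then $f$ is a cyclic vector for $A$.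
   Context: $(\cdot,\cdot)$ is the inner product of $H$. A vector $f\in C^\infty(A)$ is called a cyclic vector for $A$ if the closed linear span of $f,Af,A^2f,\dots$ is all of $H$. In condition $2^\circ$, for fixed $k$ the expression is considered for $n>|k|$. *)

theory Defs
  imports "HOL-Analysis.Analysis"
begin

section \<open>Complex Hilbert spaces\<close>

text \<open>The real structure, norm, metric and topology come from the real normed space underlying the
  complex one; the axioms tie them to the complex scalar multiplication and the inner product.
  The inner product is linear in its first argument.\<close>

class complex_inner = real_normed_vector +
  fixes scaleC :: "complex \<Rightarrow> 'a \<Rightarrow> 'a"  (infixr \<open>*\<^sub>C\<close> 75)
    and cinner :: "'a \<Rightarrow> 'a \<Rightarrow> complex"
  assumes scaleC_add_right: "a *\<^sub>C (x + y) = a *\<^sub>C x + a *\<^sub>C y"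
    and scaleC_add_left: "(a + b) *\<^sub>C x = a *\<^sub>C x + b *\<^sub>C x"
    and scaleC_scaleC: "a *\<^sub>C (b *\<^sub>C x) = (a * b) *\<^sub>C x"
    and scaleC_one: "1 *\<^sub>C x = x"
    and scaleR_scaleC: "r *\<^sub>R x = complex_of_real r *\<^sub>C x"
    and cinner_commute: "cinner x y = cnj (cinner y x)"
    and cinner_add_left: "cinner (x + y) z = cinner x z + cinner y z"
    and cinner_scaleC_left: "cinner (a *\<^sub>C x) y = a * cinner x y"
    and cinner_ge_zero: "0 \<le> Re (cinner x x)"
    and cinner_eq_zero_iff: "cinner x x = 0 \<longleftrightarrow> x = 0"
    and norm_eq_sqrt_cinner: "norm x = sqrt (Re (cinner x x))"

class complex_hilbert_space = complex_inner + complete_space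

subclass (in complex_hilbert_space) banach ..

instantiation complex :: complex_hilbert_space
begin

definition scaleC_complex :: "complex \<Rightarrow> complex \<Rightarrow> complex"
  where "scaleC_complex a x = a * x"

definition cinner_complex :: "complex \<Rightarrow> complex \<Rightarrow> complex"
  where "cinner_complex x y = x * cnj y"

instance
  by standard
    (auto simp: scaleC_complex_def cinner_complex_def algebra_simps scaleR_conv_of_real
      cmod_def power2_eq_square)

end

global_interpretation complex_vector: vector_space
    "scaleC :: complex \<Rightarrow> 'a \<Rightarrow> 'a :: complex_inner"
  defines csubspace = complex_vector.subspace
    and cspan = complex_vector.span
    and cdim = complex_vector.dim
  by unfold_locales (auto simp: scaleC_add_right scaleC_add_left scaleC_scaleC scaleC_one)

definition orthonormal_basis :: "('i \<Rightarrow> 'a :: complex_hilbert_space) \<Rightarrow> bool"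
  where "orthonormal_basis e \<longleftrightarrow>
    (\<forall>i j. cinner (e i) (e j) = (if i = j then 1 else 0)) \<and> closure (cspan (range e)) = UNIV"


section \<open>Unbounded operators\<close>

text \<open>An operator is given by a domain \<open>D\<close> and a map \<open>A\<close> of which only the values on \<open>D\<close> matter.\<close>

definition linear_operator :: "'a set \<Rightarrow> ('a \<Rightarrow> 'a :: complex_hilbert_space) \<Rightarrow> bool"
  where "linear_operator D A \<longleftrightarrow> csubspace D \<and>
    (\<forall>x\<in>D. \<forall>y\<in>D. A (x + y) = A x + A y) \<and> (\<forall>c. \<forall>x\<in>D. A (c *\<^sub>C x) = c *\<^sub>C A x)"

definition operator_graph :: "'a set \<Rightarrow> ('a \<Rightarrow> 'a) \<Rightarrow> ('a \<times> 'a) set"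
  where "operator_graph D A = {(x, A x) |x. x \<in> D}"

text \<open>The graph of the adjoint; it is single-valued when \<open>D\<close> is dense.\<close>

definition adjoint_graph ::
    "'a set \<Rightarrow> ('a \<Rightarrow> 'a) \<Rightarrow> ('a :: complex_hilbert_space \<times> 'a) set"
  where "adjoint_graph D A = {(y, z). \<forall>x\<in>D. cinner (A x) y = cinner x z}"

definition self_adjoint :: "'a set \<Rightarrow> ('a \<Rightarrow> 'a :: complex_hilbert_space) \<Rightarrow> bool"
  where "self_adjoint D A \<longleftrightarrow>
    linear_operator D A \<and> closure D = UNIV \<and> adjoint_graph D A = operator_graph D A"

definition resolvent_set :: "'a set \<Rightarrow> ('a \<Rightarrow> 'a :: complex_hilbert_space) \<Rightarrow> complex set"
  where "resolvent_set D A = {z. bij_betw (\<lambda>x. A x - z *\<^sub>C x) D UNIV \<and>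
    bounded_linear (inv_into D (\<lambda>x. A x - z *\<^sub>C x))}"

definition spectrum :: "'a set \<Rightarrow> ('a \<Rightarrow> 'a :: complex_hilbert_space) \<Rightarrow> complex set"
  where "spectrum D A = - resolvent_set D A"

definition eigenspace ::
    "'a set \<Rightarrow> ('a \<Rightarrow> 'a) \<Rightarrow> complex \<Rightarrow> 'a :: complex_hilbert_space set"
  where "eigenspace D A z = {x \<in> D. A x = z *\<^sub>C x}"

definition point_spectrum :: "'a set \<Rightarrow> ('a \<Rightarrow> 'a :: complex_hilbert_space) \<Rightarrow> complex set"
  where "point_spectrum D A = {z. \<exists>x \<in> eigenspace D A z. x \<noteq> 0}"

text \<open>The domain of the \<open>m\<close>-th power; on it the power is the iterate \<open>A ^^ m\<close>.\<close>

primrec pow_domain :: "'a set \<Rightarrow> ('a \<Rightarrow> 'a) \<Rightarrow> nat \<Rightarrow> 'a set"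
  where "pow_domain D A 0 = UNIV"
  | "pow_domain D A (Suc m) = {x \<in> D. A x \<in> pow_domain D A m}"

definition C_infinity :: "'a set \<Rightarrow> ('a \<Rightarrow> 'a) \<Rightarrow> 'a set"
  where "C_infinity D A = (\<Inter>m\<in>{1..}. pow_domain D A m)"

definition cyclic_vector :: "'a set \<Rightarrow> ('a \<Rightarrow> 'a) \<Rightarrow> 'a :: complex_hilbert_space \<Rightarrow> bool"
  where "cyclic_vector D A f \<longleftrightarrow>
    f \<in> C_infinity D A \<and> closure (cspan (range (\<lambda>m. (A ^^ m) f))) = UNIV"

definition node_poly :: "(int \<Rightarrow> real) \<Rightarrow> nat \<Rightarrow> real \<Rightarrow> real"
  where "node_poly \<mu> n x = (\<Prod>i = - int n..int n. (x - \<mu> i))"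

end

theory Submission
  imports Defs "HOL-Computational_Algebra.Polynomial"
begin

text \<open>For fixed \<open>k\<close> and \<open>n \<ge> \<bar>k\<bar>\<close> let \<open>p\<close> be the Lagrange polynomial for the nodes
  \<open>\<mu> i\<close>, \<open>\<bar>i\<bar> \<le> n\<close>, that is \<open>1\<close> at \<open>\<mu> k\<close> and \<open>0\<close> at the other nodes. Then \<open>p(A) f\<close> and
  \<open>(f, e k) e k\<close> have the same Fourier coefficients of index \<open>\<bar>s\<bar> \<le> n\<close>, so by Parseval the squared
  norm of their difference is exactly the expression in the limit condition. Hence each \<open>e k\<close> is a
  limit of polynomials in \<open>A\<close> applied to \<open>f\<close>.\<close>

section \<open>Algebra and continuity of the complex inner product and scalar multiplication\<close>

lemma cinner_add_right: "cinner x (y + z) = cinner x y + cinner x (z :: 'a :: complex_inner)"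
  by (metis cinner_add_left cinner_commute complex_cnj_add)

lemma cinner_scaleC_right: "cinner x (a *\<^sub>C y) = cnj a * cinner x (y :: 'a :: complex_inner)"
  by (metis cinner_scaleC_left cinner_commute complex_cnj_mult)

lemma cinner_zero_left: "cinner 0 (y :: 'a :: complex_inner) = 0"
  using cinner_add_left[of 0 0 y] by simp

lemma cinner_zero_right: "cinner (y :: 'a :: complex_inner) 0 = 0"
  using cinner_add_right[of y 0 0] by simp

lemma cinner_diff_left: "cinner (x - y) z = cinner x z - cinner y (z :: 'a :: complex_inner)"
  using cinner_add_left[of "x - y" y z] by simp

lemma cinner_diff_right: "cinner x (y - z) = cinner x y - cinner x (z :: 'a :: complex_inner)"
  using cinner_add_right[of x "y - z" z] by simp

lemma cinner_sum_left: "cinner (sum g F) y = (\<Sum>i\<in>F. cinner (g i) (y :: 'a :: complex_inner))"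
  by (induction F rule: infinite_finite_induct) (auto simp: cinner_zero_left cinner_add_left)

lemma cinner_sum_right: "cinner y (sum g F) = (\<Sum>i\<in>F. cinner (y :: 'a :: complex_inner) (g i))"
  by (induction F rule: infinite_finite_induct) (auto simp: cinner_zero_right cinner_add_right)

lemma cinner_self: "cinner x x = complex_of_real ((norm (x :: 'a :: complex_inner))\<^sup>2)"
proof -
  have "Im (cinner x x) = 0"
    using cinner_commute[of x x] by (metis Reals_cnj_iff complex_is_Real_iff)
  moreover have "Re (cinner x x) = (norm x)\<^sup>2"
    by (simp add: norm_eq_sqrt_cinner cinner_ge_zero)
  ultimately show ?thesis
    by (simp add: complex_eq_iff)
qed

text \<open>Both sides are nonnegative, so it suffices to compare squares; embedded in the complex
  numbers, these are inner products of a vector with itself.\<close>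

lemma norm_scaleC: "norm (a *\<^sub>C x) = cmod a * norm (x :: 'a :: complex_inner)"
proof -
  have "complex_of_real ((norm (a *\<^sub>C x))\<^sup>2) = complex_of_real ((cmod a * norm x)\<^sup>2)"
    unfolding cinner_self[symmetric, of "a *\<^sub>C x"] cinner_self[symmetric, of x]
      power_mult_distrib of_real_mult complex_norm_square
    by (simp only: cinner_scaleC_left cinner_scaleC_right mult_ac)
  then show ?thesis
    by (simp only: of_real_eq_iff) (simp add: power2_eq_iff_nonneg)
qed

lemma bounded_linear_scaleC: "bounded_linear (\<lambda>x :: 'a :: complex_inner. a *\<^sub>C x)"
  by (rule bounded_linear_intro[where K = "cmod a"])
    (auto simp: scaleC_add_right scaleR_scaleC scaleC_scaleC norm_scaleC mult.commute)

lemma csubspace_closure: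
  assumes "csubspace (S :: 'a :: complex_inner set)"
  shows "csubspace (closure S)"
  unfolding complex_vector.subspace_def
proof (intro conjI ballI allI)
  show "0 \<in> closure S"
    using complex_vector.subspace_0[OF assms] closure_subset by blast
next
  fix x y assume "x \<in> closure S" "y \<in> closure S"
  then obtain X Y where "\<And>n. X n \<in> S" "X \<longlonglongrightarrow> x" "\<And>n. Y n \<in> S" "Y \<longlonglongrightarrow> y"
    unfolding closure_sequential by metis
  then show "x + y \<in> closure S"
    unfolding closure_sequential
    by (intro exI[of _ "\<lambda>n. X n + Y n"] conjI allI complex_vector.subspace_add[OF assms]
        tendsto_add)
next
  fix c x assume "x \<in> closure S"
  then obtain X where "\<And>n. X n \<in> S" "X \<longlonglongrightarrow> x"
    unfolding closure_sequential by metis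
  then show "c *\<^sub>C x \<in> closure S"
    unfolding closure_sequential
    by (intro exI[of _ "\<lambda>n. c *\<^sub>C X n"] conjI allI complex_vector.subspace_scale[OF assms]
        bounded_linear.tendsto[OF bounded_linear_scaleC])
qed

section \<open>Parseval's identity\<close>

text \<open>Expand the square and complete it in the coefficients. Choosing the Fourier coefficients
  for \<open>c\<close> gives Bessel's inequality; dropping the last sum for arbitrary
  \<open>c\<close> bounds the distance to the span from below.\<close>

lemma norm_diff_orthonormal_combination:
  fixes x :: "'a :: complex_inner"
  assumes orth: "\<And>i j. cinner (e i) (e j) = (if i = j then 1 else 0)" and "finite F"
  shows "(norm (x - (\<Sum>i\<in>F. c i *\<^sub>C e i)))\<^sup>2 =
    (norm x)\<^sup>2 - (\<Sum>i\<in>F. (cmod (cinner x (e i)))\<^sup>2) + (\<Sum>i\<in>F. (cmod (cinner x (e i) - c i))\<^sup>2)"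
proof -
  let ?y = "\<Sum>i\<in>F. c i *\<^sub>C e i"
  have yx: "cinner ?y x = (\<Sum>i\<in>F. c i * cnj (cinner x (e i)))"
    by (simp add: cinner_sum_left cinner_scaleC_left flip: cinner_commute)
  have xy: "cinner x ?y = (\<Sum>i\<in>F. cnj (c i) * cinner x (e i))"
    by (simp add: cinner_sum_right cinner_scaleC_right)
  have yy: "cinner ?y ?y = (\<Sum>i\<in>F. c i * cnj (c i))"
    using \<open>finite F\<close>
    by (simp add: cinner_sum_left cinner_sum_right cinner_scaleC_left cinner_scaleC_right orth
        if_distrib sum.If_cases mult.commute cong: if_cong)
  have "complex_of_real ((norm (x - ?y))\<^sup>2) =
    cinner x x - cinner x ?y - cinner ?y x + cinner ?y ?y"
    by (simp add: cinner_self[symmetric] cinner_diff_left cinner_diff_right del: of_real_power)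
  also have "\<dots> = complex_of_real ((norm x)\<^sup>2 - (\<Sum>i\<in>F. (cmod (cinner x (e i)))\<^sup>2)
      + (\<Sum>i\<in>F. (cmod (cinner x (e i) - c i))\<^sup>2))"
    unfolding xy yx yy cinner_self[of x] of_real_add of_real_diff of_real_sum complex_norm_square
    by (simp add: algebra_simps sum.distrib sum_subtractf)
  finally show ?thesis
    by (simp only: of_real_eq_iff)
qed

text \<open>A linear combination of vectors in the range becomes one over indices by choosing a
  single preimage for each vector, so \<open>e\<close> may be non-injective.\<close>

lemma cspan_range_combination:
  assumes "y \<in> cspan (range e)"
  obtains F c where "finite F" "y = (\<Sum>i\<in>F. c i *\<^sub>C e i)"
proof -
  obtain t r where t: "finite t" "t \<subseteq> range e" and y: "y = (\<Sum>a\<in>t. r a *\<^sub>C a)"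
    using assms unfolding complex_vector.span_explicit by blast
  then obtain F where F: "inj_on e F" "t = e ` F"
    by (metis subset_image_inj)
  show ?thesis
    using that[of F "\<lambda>i. r (e i)"] t F y by (simp add: finite_image_iff sum.reindex)
qed

text \<open>Bessel's inequality gives summability and the upper bound; density of the span gives the
  lower bound.\<close>

theorem parseval_has_sum:
  fixes x :: "'a :: complex_hilbert_space"
  assumes "orthonormal_basis e"
  shows "((\<lambda>i. (cmod (cinner x (e i)))\<^sup>2) has_sum (norm x)\<^sup>2) UNIV"
proof -
  let ?g = "\<lambda>i. (cmod (cinner x (e i)))\<^sup>2"
  have orth: "\<And>i j. cinner (e i) (e j) = (if i = j then 1 else 0)"
    and dense: "closure (cspan (range e)) = UNIV"
    using assms by (auto simp: orthonormal_basis_def)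
  note expand = norm_diff_orthonormal_combination[of e, OF orth]
  have bessel: "sum ?g F \<le> (norm x)\<^sup>2" if "finite F" for F
    using expand[OF that, of x "\<lambda>i. cinner x (e i)"]
      zero_le_power2[of "norm (x - (\<Sum>i\<in>F. cinner x (e i) *\<^sub>C e i))"]
    by simp
  have summable: "?g summable_on UNIV"
    by (rule nonneg_bdd_above_summable_on) (auto intro!: bdd_aboveI2 bessel)
  have approx: "(norm x)\<^sup>2 \<le> infsum ?g UNIV + d\<^sup>2" if "d > 0" for d
  proof -
    have "x \<in> closure (cspan (range e))"
      by (simp add: dense)
    then obtain y where y: "y \<in> cspan (range e)" "dist y x < d"
      using \<open>d > 0\<close> unfolding closure_approachable by blast
    from y(1) obtain F c where F: "finite F" "y = (\<Sum>i\<in>F. c i *\<^sub>C e i)"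
      by (rule cspan_range_combination)
    have "(norm x)\<^sup>2 - sum ?g F \<le> (norm (x - y))\<^sup>2"
      unfolding F(2) expand[OF F(1)] by (simp add: sum_nonneg)
    also have "\<dots> \<le> d\<^sup>2"
      using y(2) by (intro power_mono) (auto simp: dist_norm norm_minus_commute)
    finally show ?thesis
      using finite_sum_le_infsum[OF summable F(1)] by simp
  qed
  have "(norm x)\<^sup>2 \<le> infsum ?g UNIV"
  proof (rule field_le_epsilon)
    fix r :: real assume "r > 0"
    then show "(norm x)\<^sup>2 \<le> infsum ?g UNIV + r"
      \<comment> \<open>The error in \<open>approx\<close> is quadratic in \<open>d\<close>, hence
        the square root.\<close>
      using approx[of "sqrt r"] by simp
  qed
  moreover have "infsum ?g UNIV \<le> (norm x)\<^sup>2"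
    by (rule infsum_le_finite_sums[OF summable]) (auto intro: bessel)
  ultimately show ?thesis
    using has_sum_infsum[OF summable] by (metis order_antisym)
qed

section \<open>Polynomials in the operator\<close>

lemma funpow_in_domain:
  assumes "x \<in> C_infinity D A"
  shows "(A ^^ m) x \<in> D"
proof -
  have "x \<in> pow_domain D A (Suc m) \<Longrightarrow> (A ^^ m) x \<in> D" for x
    by (induction m arbitrary: x) (auto simp: funpow_swap1)
  moreover have "x \<in> pow_domain D A (Suc m)"
    using assms unfolding C_infinity_def by (rule INT_D) simp
  ultimately show ?thesis .
qed

text \<open>The graph of \<open>A\<close> lies in the adjoint graph, so \<open>A\<close> moves
  across to \<open>u\<close>; the eigenvalue is real, so conjugation does not change it.\<close>

lemma cinner_eigenvector:
  assumes "self_adjoint D A" "x \<in> D" "u \<in> D" "A u = complex_of_real r *\<^sub>C u"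
  shows "cinner (A x) u = complex_of_real r * cinner x u"
proof -
  have "(u, A u) \<in> adjoint_graph D A"
    using assms(1,3) by (auto simp: self_adjoint_def operator_graph_def)
  then show ?thesis
    using assms(2,4) by (auto simp: adjoint_graph_def cinner_scaleC_right)
qed

definition poly_apply :: "real poly \<Rightarrow> ('a \<Rightarrow> 'a) \<Rightarrow> 'a \<Rightarrow> 'a :: complex_hilbert_space"
  where "poly_apply p A f = (\<Sum>i\<le>degree p. complex_of_real (coeff p i) *\<^sub>C (A ^^ i) f)"

lemma poly_apply_in_cspan: "poly_apply p A f \<in> cspan (range (\<lambda>m. (A ^^ m) f))"
  unfolding poly_apply_def
  by (intro complex_vector.span_sum complex_vector.span_scale complex_vector.span_base) auto

text \<open>Each power of \<open>A\<close> is moved onto the eigenvector one factor at a time. This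
  is legitimate because all iterates of \<open>f\<close> stay in \<open>D\<close>.\<close>

lemma cinner_poly_apply:
  assumes "self_adjoint D A" "f \<in> C_infinity D A" "u \<in> D" "A u = complex_of_real r *\<^sub>C u"
  shows "cinner (poly_apply p A f) u = complex_of_real (poly p r) * cinner f u"
proof -
  have "cinner ((A ^^ m) f) u = complex_of_real (r ^ m) * cinner f u" for m
    using cinner_eigenvector[OF assms(1) funpow_in_domain[OF assms(2)] assms(3,4)]
    by (induction m) auto
  then show ?thesis
    by (simp add: poly_apply_def poly_altdef cinner_sum_left cinner_scaleC_left sum_distrib_right
        mult.assoc)
qed

section \<open>Lagrange polynomials for the eigenvalues\<close>

lemma strict_mono_int:
  fixes \<mu> :: "int \<Rightarrow> 'b :: order"
  assumes "\<And>j. \<mu> j < \<mu> (j + 1)"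
  shows "strict_mono \<mu>"
proof (rule strict_monoI)
  fix i j :: int assume "i < j"
  then show "\<mu> i < \<mu> j"
    by (induction j rule: int_gr_induct) (use assms less_trans in blast)+
qed

text \<open>Normalising by the derivative of the node polynomial, which equals the usual product of
  node differences when \<open>k\<close> is among the indices, produces the prefactor of the limit
  condition directly.\<close>

definition lagrange_poly :: "(int \<Rightarrow> real) \<Rightarrow> nat \<Rightarrow> int \<Rightarrow> real poly"
  where "lagrange_poly \<mu> n k =
    smult (1 / deriv (node_poly \<mu> n) (\<mu> k)) (\<Prod>i\<in>{- int n..int n} - {k}. [:- \<mu> i, 1:])"

lemma node_poly_eq:
  assumes "\<bar>k\<bar> \<le> int n"
  shows "node_poly \<mu> n x = (x - \<mu> k) * (\<Prod>i\<in>{- int n..int n} - {k}. x - \<mu> i)"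
  unfolding node_poly_def using assms by (intro prod.remove) auto

text \<open>Product rule: the factor \<open>x - \<mu> k\<close> vanishes at \<open>\<mu> k\<close>,
  so only the term that differentiates it survives.\<close>

lemma deriv_node_poly:
  assumes "\<bar>k\<bar> \<le> int n"
  shows "deriv (node_poly \<mu> n) (\<mu> k) = (\<Prod>i\<in>{- int n..int n} - {k}. \<mu> k - \<mu> i)"
proof -
  define q where "q = (\<Prod>i\<in>{- int n..int n} - {k}. [:- \<mu> i, 1:])"
  have q: "poly q x = (\<Prod>i\<in>{- int n..int n} - {k}. x - \<mu> i)" for x
    by (simp add: q_def poly_prod)
  have "node_poly \<mu> n = (\<lambda>x. (x - \<mu> k) * poly q x)"
    using node_poly_eq[OF assms] by (auto simp: q)
  moreover have "((\<lambda>x. (x - \<mu> k) * poly q x) has_field_derivative poly q (\<mu> k)) (at (\<mu> k))"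
    by (auto intro!: derivative_eq_intros poly_DERIV)
  ultimately show ?thesis
    by (simp add: DERIV_imp_deriv q)
qed

lemma poly_lagrange_poly:
  "poly (lagrange_poly \<mu> n k) x =
    (\<Prod>i\<in>{- int n..int n} - {k}. x - \<mu> i) / deriv (node_poly \<mu> n) (\<mu> k)"
  by (simp add: lagrange_poly_def poly_prod)

text \<open>At another node some factor vanishes; at \<open>\<mu> k\<close> numerator and
  denominator agree and are nonzero by injectivity.\<close>

lemma poly_lagrange_poly_node:
  assumes "inj \<mu>" "\<bar>k\<bar> \<le> int n" "\<bar>s\<bar> \<le> int n"
  shows "poly (lagrange_poly \<mu> n k) (\<mu> s) = (if s = k then 1 else 0)"
  using assms
  by (auto simp: poly_lagrange_poly deriv_node_poly inj_eq)

lemma poly_lagrange_poly_outside: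
  assumes "inj \<mu>" "\<bar>k\<bar> \<le> int n" "s \<noteq> k"
  shows "poly (lagrange_poly \<mu> n k) (\<mu> s) =
    node_poly \<mu> n (\<mu> s) / ((\<mu> s - \<mu> k) * deriv (node_poly \<mu> n) (\<mu> k))"
  using assms by (simp add: poly_lagrange_poly node_poly_eq[OF assms(2)] inj_eq)

section \<open>Approximating eigenvectors by polynomials in \<open>A\<close> applied to
  \<open>f\<close>\<close>

lemma norm_lagrange_approx:
  fixes f :: "'a :: complex_hilbert_space" and \<mu> :: "int \<Rightarrow> real"
  assumes "self_adjoint D A" "inj \<mu>" "orthonormal_basis e"
    and eig: "\<And>j. e j \<in> D \<and> A (e j) = complex_of_real (\<mu> j) *\<^sub>C e j"
    and f: "f \<in> C_infinity D A" and k: "\<bar>k\<bar> \<le> int n"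
  shows "(norm (poly_apply (lagrange_poly \<mu> n k) A f - cinner f (e k) *\<^sub>C e k))\<^sup>2 =
    1 / (deriv (node_poly \<mu> n) (\<mu> k))\<^sup>2 * (\<Sum>\<^sub>\<infinity>s\<in>{s. \<bar>s\<bar> > int n}.
      (node_poly \<mu> n (\<mu> s))\<^sup>2 * (cmod (cinner f (e s)))\<^sup>2 / (\<mu> s - \<mu> k)\<^sup>2)"
proof -
  let ?p = "lagrange_poly \<mu> n k" and ?d = "deriv (node_poly \<mu> n) (\<mu> k)"
  let ?v = "poly_apply ?p A f - cinner f (e k) *\<^sub>C e k"
  have orth: "cinner (e i) (e j) = (if i = j then 1 else 0)" for i j
    using assms(3) by (auto simp: orthonormal_basis_def)
  have coeff: "cinner ?v (e s) =
    (complex_of_real (poly ?p (\<mu> s)) - (if s = k then 1 else 0)) * cinner f (e s)" for s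
    using cinner_poly_apply[OF assms(1) f, of "e s" "\<mu> s" ?p] eig[of s]
    by (auto simp: cinner_diff_left cinner_scaleC_left orth algebra_simps)
  have "(norm ?v)\<^sup>2 = (\<Sum>\<^sub>\<infinity>s. (cmod (cinner ?v (e s)))\<^sup>2)"
    using infsumI[OF parseval_has_sum[OF assms(3)]] by metis
  also have "\<dots> = (\<Sum>\<^sub>\<infinity>s\<in>{s. \<bar>s\<bar> > int n}. 1 / ?d\<^sup>2 *
      ((node_poly \<mu> n (\<mu> s))\<^sup>2 * (cmod (cinner f (e s)))\<^sup>2 / (\<mu> s - \<mu> k)\<^sup>2))"
  \<comment> \<open>The coefficients with \<open>\<bar>s\<bar> \<le> int n\<close> vanish by
    interpolation, which leaves the tail sum.\<close>
  proof (rule infsum_cong_neutral)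
    fix s assume "s \<in> UNIV - {s. \<bar>s\<bar> > int n}"
    then show "(cmod (cinner ?v (e s)))\<^sup>2 = 0"
      using poly_lagrange_poly_node[OF assms(2) k, of s] by (simp add: coeff)
  next
    fix s assume "s \<in> UNIV \<inter> {s. \<bar>s\<bar> > int n}"
    then have "s \<noteq> k"
      using k by auto
    then show "(cmod (cinner ?v (e s)))\<^sup>2 = 1 / ?d\<^sup>2 *
      ((node_poly \<mu> n (\<mu> s))\<^sup>2 * (cmod (cinner f (e s)))\<^sup>2 / (\<mu> s - \<mu> k)\<^sup>2)"
      using poly_lagrange_poly_outside[OF assms(2) k, of s]
      by (simp add: coeff norm_mult power_mult_distrib power_divide mult_ac
          del: of_real_divide of_real_mult of_real_diff)
  qed auto
  finally show ?thesis
    by (simp only: infsum_cmult_right')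
qed

theorem theorem2:
  fixes D :: "'a :: complex_hilbert_space set"
    and A :: "'a \<Rightarrow> 'a"
    and \<mu> :: "int \<Rightarrow> real"
    and e :: "int \<Rightarrow> 'a"
    and f :: 'a
  assumes separable: "separable_space (euclidean :: 'a topology)"
    and self_adjoint: "self_adjoint D A"
    and increasing: "\<And>j. \<mu> j < \<mu> (j + 1)"
    and eigenvalues: "point_spectrum D A = range (\<lambda>j. complex_of_real (\<mu> j))"
    and pure_point: "spectrum D A \<subseteq> closure (point_spectrum D A)"
    and simple: "\<And>j. cdim (eigenspace D A (complex_of_real (\<mu> j))) = 1"
    and basis: "orthonormal_basis e"
    and eigenvectors: "\<And>j. e j \<in> D \<and> A (e j) = complex_of_real (\<mu> j) *\<^sub>C e j"
    and smooth: "f \<in> C_infinity D A"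
    and nonzero: "\<And>k. cinner f (e k) \<noteq> 0"
    and limit: "\<And>k. (\<lambda>n. 1 / (deriv (node_poly \<mu> n) (\<mu> k))\<^sup>2 *
        (\<Sum>\<^sub>\<infinity>s\<in>{s. \<bar>s\<bar> > int n}.
          (node_poly \<mu> n (\<mu> s))\<^sup>2 * (cmod (cinner f (e s)))\<^sup>2 / (\<mu> s - \<mu> k)\<^sup>2))
      \<longlonglongrightarrow> 0"
  shows "cyclic_vector D A f"
proof -
  let ?S = "cspan (range (\<lambda>m. (A ^^ m) f))"
  have inj: "inj \<mu>"
    using strict_mono_int[of \<mu>, OF increasing] by (rule strict_mono_imp_inj_on)
  have sub: "csubspace (closure ?S)"
    by (intro csubspace_closure complex_vector.subspace_span)
  have "e k \<in> closure ?S" for k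
  proof -
    let ?u = "\<lambda>n. poly_apply (lagrange_poly \<mu> n k) A f" and ?w = "cinner f (e k) *\<^sub>C e k"
    \<comment> \<open>The error formula requires \<open>k\<close> to be among the node indices; the
      limit only sees such \<open>n\<close>.\<close>
    have "eventually (\<lambda>n. \<bar>k\<bar> \<le> int n) sequentially"
      using eventually_ge_at_top[of "nat \<bar>k\<bar>"] by eventually_elim auto
    then have "(\<lambda>n. (norm (?u n - ?w))\<^sup>2) \<longlonglongrightarrow> 0"
      by (intro Lim_transform_eventually[OF limit[of k]])
        (auto elim!: eventually_mono
          simp: norm_lagrange_approx[OF self_adjoint inj basis eigenvectors smooth])
    from tendsto_real_sqrt[OF this] have "?u \<longlonglongrightarrow> ?w"
      by (simp add: LIM_zero_iff tendsto_norm_zero_iff)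
    then have "?w \<in> closure ?S"
      unfolding closure_sequential by (intro exI[of _ ?u] conjI allI poly_apply_in_cspan)
    \<comment> \<open>The closure is a complex subspace, so the nonzero coefficient can be divided
      out.\<close>
    then have "inverse (cinner f (e k)) *\<^sub>C ?w \<in> closure ?S"
      by (rule complex_vector.subspace_scale[OF sub])
    then show ?thesis
      using nonzero[of k] by (simp add: scaleC_scaleC scaleC_one)
  qed
  \<comment> \<open>The closed subspace contains every \<open>e k\<close>, hence their span, and
    hence the closure of that span, which is the whole space.\<close>
  then have "cspan (range e) \<subseteq> closure ?S"
    by (intro complex_vector.span_minimal[OF _ sub]) auto
  then have "closure ?S = UNIV"
    using basis closure_minimal[of "cspan (range e)" "closure ?S"]
    by (auto simp: orthonormal_basis_def)
  then show ?thesis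
    using smooth by (simp add: cyclic_vector_def)
qed

end
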